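(* Let $f:\mathbb{R}^N\to\mathbb{R}$ be convex and differentiable. Let $\hat S$ be an arbitrary proper sampling with probability vector $p=(p_1,\dots,p_n)$ and let $v\in\mathbb{R}^n_{++}$ be such that $(f,\hat S)\sim ESO(v)$. Choose $\theta_0\in(0,1]$ and set $\theta_k=\theta_0$ for all $k\ge 0$. Then for any $y\in\mathbb{R}^N$, the iterates $\{x_k\}_{k\ge1}$ of the smooth ALPHA algorithm satisfy, for all $k\ge 1$, $$\max\Big\{\mathbf{E}[f(\hat x_k)],\ \min_{l=1,\dots,k}\mathbf{E}[f(x_l)]\Big\}-f(y)\ \le\ \frac{C}{(k-1)\theta_0+1},$$ where $$\hat x_k=\frac{x_k+\theta_0\sum_{l=1}^{k-1}x_l}{1+(k-1)\theta_0},\qquad C=(1-\theta_0)\big(f(x_0)-f(y)\big)+\frac{\theta_0^2}{2}\|x_0-y\|^2_{v\circ p^{-2}}.$$ In particular, if $\theta_0=\min_i p_i$, then for all $k\ge1$, $$\max\Big\{\mathbf{E}[f(\hat x_k)],\ \min_{l=1,\dots,k}\mathbf{E}[f(x_l)]\Big\}-f(y)\ \le\ \frac{(1-\min_i p_i)\big(f(x_0)-f(y)\big)+\frac12\|x_0-y\|_v^2}{(k-1)\min_i p_i+1}.$$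
   Context: Block structure: $\mathbb{R}^N=\mathbb{R}^{N_1}\times\dots\times\mathbb{R}^{N_n}$, $[n]=\{1,\dots,n\}$; $x^i\in\mathbb{R}^{N_i}$ is the $i$th block of $x\in\mathbb{R}^N$, and $U_i$ is the $N\times N_i$ column submatrix of the identity with $x^i=U_i^\top x$. For $S\subseteq[n]$, $h_{[S]}=\sum_{i\in S}U_ih^i$. $\nabla_i f(x)=U_i^\top\nabla f(x)$. $\langle\cdot,\cdot\rangle$ is the standard inner product. For each $i$, $B_i$ is a fixed (symmetric) positive definite $N_i\times N_i$ matrix and $\|x^i\|_i^2=\langle B_ix^i,x^i\rangle$. For $w\in\mathbb{R}^n_{++}$ (vectors with positive entries): $\langle x,y\rangle_w=\sum_i w_i\langle x^i,y^i\rangle$ and $\|x\|_w^2=\sum_i w_i\|x^i\|_i^2$. For vectors in $\mathbb{R}^n$: $\circ$ is the elementwise product, and $p^{-1},p^{-2}$ are elementwise powers. For $u\in\mathbb{R}^n$, $x\in\mathbb{R}^N$: $u\cdot x=\sum_i u_iU_ix^i$. Sampling: a sampling $\hat S$ is a random subset of $[n]$; $p_i=\mathrm{Prob}(i\in\hat S)$; it is proper if $p_i>0$ for all $i$. ESO: $(f,\hat S)\sim ESO(v)$ means that for all $x,h\in\mathbb{R}^N$, $\mathbf{E}[f(x+h_{[\hat S]})]\le f(x)+\langle\nabla f(x),h\rangle_p+\frac12\|h\|^2_{v\circ p}$. Smooth ALPHA algorithm (parameters $\hat S,v,\{\theta_k\}_{k\ge0}$): choose $x_0\in\mathbb{R}^N$,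 set $z_0=x_0$. For $k\ge0$: $y_k=(1-\theta_k)x_k+\theta_kz_k$; draw a random set $S_k$ with the distribution of $\hat S$, independently of the past; set $z_{k+1}^i=z_k^i-\frac{p_i}{v_i\theta_k}B_i^{-1}\nabla_if(y_k)$ for $i\in S_k$ and $z_{k+1}^i=z_k^i$ for $i\notin S_k$; set $x_{k+1}=y_k+\theta_kp^{-1}\cdot(z_{k+1}-z_k)$. *)

theory Defs
  imports "HOL-Probability.Probability"
begin

text \<open>
  The block structure is a map \<open>b :: 'm \<Rightarrow> 'n\<close> assigning to each of the \<open>N = CARD('m)\<close> coordinates
  the block it belongs to; there are \<open>n = CARD('n)\<close> blocks, and \<open>N\<^sub>i\<close> is the number of
  coordinates in \<open>{j. b j = i}\<close>.  Vectors of length \<open>N\<^sub>i\<close> and \<open>N\<^sub>i \<times> N\<^sub>i\<close> matrices are padded with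
  zeros outside block \<open>i\<close>: the vector \<open>x\<^sup>i\<close> is represented by \<open>U\<^sub>i x\<^sup>i\<close>, and the matrix \<open>A\<close> by
  \<open>U\<^sub>i A U\<^sub>i\<^sup>T\<close>.  This preserves sums, products, transposes and inner products.
\<close>

definition blk :: "('m::finite \<Rightarrow> 'n::finite) \<Rightarrow> 'n \<Rightarrow> real^'m \<Rightarrow> real^'m" where
  "blk b i x = (\<chi> j. if b j = i then x $ j else 0)"

definition blk_matrix :: "('m::finite \<Rightarrow> 'n::finite) \<Rightarrow> 'n \<Rightarrow> real^'m^'m \<Rightarrow> bool" where
  "blk_matrix b i A \<longleftrightarrow> (\<forall>j l. \<not> (b j = i \<and> b l = i) \<longrightarrow> A $ j $ l = 0)"

text \<open>The identity matrix of size \<open>N\<^sub>i\<close>, padded.\<close>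

definition blk_id :: "('m::finite \<Rightarrow> 'n::finite) \<Rightarrow> 'n \<Rightarrow> real^'m^'m" where
  "blk_id b i = (\<chi> j l. if j = l \<and> b j = i then 1 else 0)"

text \<open>The inverse of an \<open>N\<^sub>i \<times> N\<^sub>i\<close> matrix, padded (not the inverse of the padded matrix, which is
  singular as soon as there is a coordinate outside block \<open>i\<close>).\<close>

definition blk_inv :: "('m::finite \<Rightarrow> 'n::finite) \<Rightarrow> 'n \<Rightarrow> real^'m^'m \<Rightarrow> real^'m^'m" where
  "blk_inv b i A = (THE C. blk_matrix b i C \<and> C ** A = blk_id b i \<and> A ** C = blk_id b i)"

definition blk_pos_def :: "('m::finite \<Rightarrow> 'n::finite) \<Rightarrow> 'n \<Rightarrow> real^'m^'m \<Rightarrow> bool" where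
  "blk_pos_def b i A \<longleftrightarrow>
     blk_matrix b i A \<and> transpose A = A \<and>
     (\<forall>x. blk b i x \<noteq> 0 \<longrightarrow> 0 < (A *v blk b i x) \<bullet> blk b i x)"

text \<open>\<open>h\<^bsub>[S]\<^esub>\<close>\<close>

definition blk_restrict :: "('m::finite \<Rightarrow> 'n::finite) \<Rightarrow> 'n set \<Rightarrow> real^'m \<Rightarrow> real^'m" where
  "blk_restrict b S h = (\<Sum>i\<in>S. blk b i h)"

text \<open>\<open>u \<cdot> x\<close>\<close>

definition blk_scale :: "('m::finite \<Rightarrow> 'n::finite) \<Rightarrow> real^'n \<Rightarrow> real^'m \<Rightarrow> real^'m" where
  "blk_scale b u x = (\<Sum>i\<in>UNIV. (u $ i) *\<^sub>R blk b i x)"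

definition winner :: "('m::finite \<Rightarrow> 'n::finite) \<Rightarrow> real^'n \<Rightarrow> real^'m \<Rightarrow> real^'m \<Rightarrow> real" where
  "winner b w x y = (\<Sum>i\<in>UNIV. w $ i * (blk b i x \<bullet> blk b i y))"

text \<open>The squared norm \<open>\<parallel>x\<parallel>\<^sub>w\<^sup>2\<close>\<close>

definition wnorm_sq ::
    "('m::finite \<Rightarrow> 'n::finite) \<Rightarrow> ('n \<Rightarrow> real^'m^'m) \<Rightarrow> real^'n \<Rightarrow> real^'m \<Rightarrow> real" where
  "wnorm_sq b B w x = (\<Sum>i\<in>UNIV. w $ i * ((B i *v blk b i x) \<bullet> blk b i x))"

definition vmult :: "real^'n \<Rightarrow> real^'n \<Rightarrow> real^'n" (infixl "\<circ>\<^sub>v" 70) where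
  "u \<circ>\<^sub>v w = (\<chi> i. u $ i * w $ i)"

definition vpowi :: "real^'n \<Rightarrow> int \<Rightarrow> real^'n" where
  "vpowi u k = (\<chi> i. (u $ i) powi k)"

definition grad :: "('a::real_inner \<Rightarrow> real) \<Rightarrow> 'a \<Rightarrow> 'a" where
  "grad f x = (THE D. GDERIV f x :> D)"

text \<open>A sampling is given by its law, a probability distribution on the subsets of the set of
  blocks.\<close>

definition sampling_prob :: "'n::finite set pmf \<Rightarrow> real^'n" where
  "sampling_prob Shat = (\<chi> i. measure_pmf.prob Shat {s. i \<in> s})"

definition proper_sampling :: "'n::finite set pmf \<Rightarrow> bool" where
  "proper_sampling Shat \<longleftrightarrow> (\<forall>i. 0 < sampling_prob Shat $ i)"

definition ESO ::
    "('m::finite \<Rightarrow> 'n::finite) \<Rightarrow> ('n \<Rightarrow> real^'m^'m) \<Rightarrow> (real^'m \<Rightarrow> real) \<Rightarrow> 'n set pmf \<Rightarrow> real^'n \<Rightarrow> bool"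
  where
  "ESO b B f Shat v \<longleftrightarrow>
     (\<forall>x h. measure_pmf.expectation Shat (\<lambda>s. f (x + blk_restrict b s h))
        \<le> f x + winner b (sampling_prob Shat) (grad f x) h
           + 1/2 * wnorm_sq b B (v \<circ>\<^sub>v sampling_prob Shat) h)"

text \<open>The sequences \<open>x\<close>, \<open>y\<close>, \<open>z\<close> are those generated by smooth ALPHA from the starting point \<open>x0\<close>
  when the sets drawn are \<open>s 0, s 1, \<dots>\<close>.\<close>

definition smooth_ALPHA ::
    "('m::finite \<Rightarrow> 'n::finite) \<Rightarrow> ('n \<Rightarrow> real^'m^'m) \<Rightarrow> (real^'m \<Rightarrow> real) \<Rightarrow> real^'n \<Rightarrow> real^'n \<Rightarrow>
     (nat \<Rightarrow> real) \<Rightarrow> real^'m \<Rightarrow> (nat \<Rightarrow> 'n set) \<Rightarrow>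
     (nat \<Rightarrow> real^'m) \<Rightarrow> (nat \<Rightarrow> real^'m) \<Rightarrow> (nat \<Rightarrow> real^'m) \<Rightarrow> bool" where
  "smooth_ALPHA b B f p v \<theta> x0 s x y z \<longleftrightarrow>
     x 0 = x0 \<and> z 0 = x0 \<and>
     (\<forall>k. y k = (1 - \<theta> k) *\<^sub>R x k + \<theta> k *\<^sub>R z k \<and>
       (\<forall>i\<in>s k. blk b i (z (Suc k)) =
          blk b i (z k) - (p $ i / (v $ i * \<theta> k)) *\<^sub>R (blk_inv b i (B i) *v blk b i (grad f (y k)))) \<and>
       (\<forall>i. i \<notin> s k \<longrightarrow> blk b i (z (Suc k)) = blk b i (z k)) \<and>
       x (Suc k) = y k + \<theta> k *\<^sub>R blk_scale b (vpowi p (-1)) (z (Suc k) - z k))"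

definition ALPHA_average :: "real \<Rightarrow> (nat \<Rightarrow> 'a::real_vector) \<Rightarrow> nat \<Rightarrow> 'a" where
  "ALPHA_average \<theta>\<^sub>0 x k =
     (1 / (1 + (real k - 1) * \<theta>\<^sub>0)) *\<^sub>R (x k + \<theta>\<^sub>0 *\<^sub>R (\<Sum>l=1..k-1. x l))"

end

theory Submission
  imports Defs
begin

text \<open>
  Freeze the current iterates \<open>x\<close>, \<open>z\<close>, put \<open>u = (1 - \<theta>) x + \<theta> z\<close>, and let \<open>d\<close> be the displacement
  of \<open>z\<close> that the algorithm would make if all blocks were drawn, so that the real one is
  \<open>d\<^bsub>[S]\<^esub>\<close>.  The next \<open>x\<close> is \<open>u + h\<^bsub>[S]\<^esub>\<close> with \<open>h = \<theta> p\<^sup>-\<^sup>1 \<cdot> d\<close>, and the ESO at \<open>h\<close> bounds the mean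
  of \<open>f\<close> there by the value at \<open>d\<close> of the separable quadratic
  \<open>f u + \<theta> \<langle>\<nabla>f u, d\<rangle> + \<theta>\<^sup>2/2 \<parallel>d\<parallel>\<^sup>2\<close>, with norm weights \<open>v \<circ> p\<^sup>-\<^sup>1\<close>.  This quadratic is minimal at \<open>d\<close>,
  and the value at the minimum is the value at any other \<open>y - z\<close> minus \<open>\<theta>\<^sup>2/2 \<parallel>z + d - y\<parallel>\<^sup>2\<close>
  (\<open>ALPHA_dir_three_point\<close>).  Block \<open>i\<close> of \<open>z\<close> moves with probability \<open>p\<^sub>i\<close> only; this turns the
  weights \<open>v \<circ> p\<^sup>-\<^sup>1\<close> on the full displacement into \<open>v \<circ> p\<^sup>-\<^sup>2\<close> on the actual one, and convexity of \<open>f\<close>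
  at \<open>u\<close> absorbs the gradient.  The outcome (\<open>ALPHA_step_expectation\<close>) is that, with
  \<open>a\<^sub>k = E f(x\<^sub>k) - f y\<close> and \<open>r\<^sub>k = \<theta>\<^sup>2/2 E \<parallel>z\<^sub>k - y\<parallel>\<^sup>2\<close>, where the norm has weights \<open>v \<circ> p\<^sup>-\<^sup>2\<close>,

  \<open>a\<^sub>k\<^sub>+\<^sub>1 + r\<^sub>k\<^sub>+\<^sub>1 \<le> (1 - \<theta>) a\<^sub>k + r\<^sub>k\<close>.

  Summing over \<open>k\<close> makes \<open>r\<close> telescope and leaves
  \<open>a\<^sub>k + \<theta> (a\<^sub>1 + \<dots> + a\<^sub>k\<^sub>-\<^sub>1) \<le> (1 - \<theta>) a\<^sub>0 + r\<^sub>0 = C\<close>.  The weights on the left add up to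
  \<open>1 + (k - 1) \<theta>\<close>, so both the smallest \<open>a\<^sub>l\<close> and, by Jensen's inequality, the gap at the
  averaged iterate are at most \<open>C / (1 + (k - 1) \<theta>)\<close>.  For \<open>\<theta> = min\<^sub>i p\<^sub>i\<close> one has \<open>\<theta>\<^sup>2 / p\<^sub>i\<^sup>2 \<le> 1\<close>, which
  gives the second bound.

  The probabilistic content is that the iterates of step \<open>k\<close> are functions of the first \<open>k\<close>
  sets drawn, which take finitely many values and are independent of the next set; hence everything
  is integrable and the one-step estimate may be averaged over the past.
\<close>

section \<open>Blocks of a vector\<close>

lemma blk_eqI: "(\<And>i. blk b i x = blk b i y) \<Longrightarrow> x = y"
  by (simp add: vec_eq_iff blk_def) metis

lemma linear_blk: "linear (blk b i)"
  by (rule linearI) (auto simp: blk_def vec_eq_iff)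

lemmas blk_add = linear_add [OF linear_blk]
  and blk_diff = linear_diff [OF linear_blk]
  and blk_minus = linear_neg [OF linear_blk]
  and blk_scaleR = linear_cmul [OF linear_blk]
  and blk_0 = linear_0 [OF linear_blk]
  and blk_sum = linear_sum [OF linear_blk]

lemma blk_blk: "blk b i (blk b j x) = (if i = j then blk b i x else 0)"
  by (auto simp: blk_def vec_eq_iff)

lemma blk_restrict_nth: "blk b i (blk_restrict b s h) = (if i \<in> s then blk b i h else 0)"
  by (simp add: blk_restrict_def blk_sum blk_blk sum.delta)

lemma blk_scale_nth: "blk b i (blk_scale b u x) = (u $ i) *\<^sub>R blk b i x"
  by (simp add: blk_scale_def blk_sum blk_scaleR blk_blk if_distrib cong: if_cong)

lemma inner_eq_sum_blk: "x \<bullet> y = (\<Sum>i\<in>UNIV. blk b i x \<bullet> blk b i y)"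
proof -
  have "(\<Sum>i\<in>UNIV. blk b i x \<bullet> blk b i y)
      = (\<Sum>i\<in>UNIV. \<Sum>j\<in>UNIV. if b j = i then x $ j * y $ j else 0)"
    unfolding inner_vec_def blk_def by (intro sum.cong refl) auto
  also have "\<dots> = (\<Sum>j\<in>UNIV. \<Sum>i\<in>UNIV. if b j = i then x $ j * y $ j else 0)"
    by (rule sum.swap)
  also have "\<dots> = x \<bullet> y"
    by (simp add: inner_vec_def)
  finally show ?thesis ..
qed

section \<open>Inverses of block matrices\<close>

lemma blk_id_vector: "blk_id b i *v x = blk b i x"
proof -
  have *: "(\<Sum>j\<in>UNIV. (if l = j \<and> b l = i then 1 else 0) * x $ j) = (if b l = i then x $ l else 0)" for l
    by (cases "b l = i") (simp_all add: if_distrib[of "\<lambda>t. t * _"] cong: if_cong)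
  show ?thesis
    by (simp add: vec_eq_iff matrix_vector_mult_def blk_id_def blk_def *)
qed

text \<open>
  Multiplication by the padded identity from either side erases the rows or columns outside the
  block, so being a padded block matrix becomes an equational condition.
\<close>

lemma blk_matrix_iff: "blk_matrix b i A \<longleftrightarrow> blk_id b i ** A = A \<and> A ** blk_id b i = A"
proof -
  have L: "(blk_id b i ** A) $ j $ l = (if b j = i then A $ j $ l else 0)" for j l
  proof -
    have "(blk_id b i ** A) $ j $ l
        = (\<Sum>k\<in>UNIV. if j = k then (if b j = i then A $ k $ l else 0) else 0)"
      unfolding matrix_matrix_mult_def blk_id_def vec_lambda_beta by (intro sum.cong) auto
    then show ?thesis by simp
  qed
  have R: "(A ** blk_id b i) $ j $ l = (if b l = i then A $ j $ l else 0)" for j l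
  proof -
    have "(A ** blk_id b i) $ j $ l
        = (\<Sum>k\<in>UNIV. if k = l then (if b l = i then A $ j $ k else 0) else 0)"
      unfolding matrix_matrix_mult_def blk_id_def vec_lambda_beta by (intro sum.cong) auto
    then show ?thesis by simp
  qed
  show ?thesis
    unfolding vec_eq_iff L R blk_matrix_def by (auto split: if_splits)
qed

lemma blk_inv_unique:
  assumes "blk_matrix b i C" "C ** A = blk_id b i" "A ** C = blk_id b i"
  shows "blk_inv b i A = C"
  unfolding blk_inv_def
proof (rule the_equality)
  show "blk_matrix b i C \<and> C ** A = blk_id b i \<and> A ** C = blk_id b i"
    using assms by simp
  fix D assume D: "blk_matrix b i D \<and> D ** A = blk_id b i \<and> A ** D = blk_id b i"
  have "D = D ** (A ** C)"
    using D assms by (simp add: blk_matrix_iff)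
  also have "\<dots> = C"
    unfolding matrix_mul_assoc using D assms by (simp add: blk_matrix_iff)
  finally show "D = C" .
qed

text \<open>
  This justifies the description operator in \<^const>\<open>blk_inv\<close>.  Completing \<open>A\<close> by the identity on the
  other coordinates yields an injective, hence invertible, matrix that commutes with the projection
  onto the block; projecting its inverse gives the inverse inside the block.
\<close>

lemma blk_inv_pos_def:
  fixes A :: "real^'m^'m"
  assumes "blk_pos_def b i A"
  shows "blk_matrix b i (blk_inv b i A)" "A ** blk_inv b i A = blk_id b i"
proof -
  define P where "P = blk_id b i"
  define A' where "A' = A + (mat 1 - P)"
  have A: "P ** A = A" "A ** P = A"
    using assms by (simp_all add: blk_pos_def_def blk_matrix_iff P_def)
  have PP: "P ** P = P"
    unfolding matrix_eq by (simp add: P_def blk_id_vector blk_blk flip: matrix_vector_mul_assoc)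
  have "x = 0" if "A' *v x = 0" for x
  proof -
    have 1: "A *v x + (x - blk b i x) = 0"
      using that by (simp add: A'_def P_def matrix_vector_mult_add_rdistrib
          matrix_vector_mult_diff_rdistrib blk_id_vector)
    have Ax: "A *v x = A *v blk b i x" "blk b i (A *v x) = A *v x"
      using A by (metis P_def blk_id_vector matrix_vector_mul_assoc)+
    have "blk b i (A *v x + (x - blk b i x)) = A *v x"
      by (simp add: blk_add blk_diff blk_blk Ax(2))
    with 1 have 0: "A *v x = 0"
      by (simp add: blk_0)
    then have "blk b i x = 0"
      using assms Ax(1) unfolding blk_pos_def_def by (metis inner_zero_left less_irrefl)
    with 0 1 show ?thesis by simp
  qed
  then have "inj ((*v) A')"
    by (simp add: linear_injective_0)
  then obtain E where E: "E ** A' = mat 1" "A' ** E = mat 1"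
    using matrix_left_invertible_injective matrix_left_right_inverse by blast
  have A'P: "A' ** P = A" "P ** A' = A"
    using A PP unfolding matrix_eq A'_def
    by (simp_all add: matrix_vector_mult_add_rdistrib matrix_vector_mult_diff_rdistrib
        matrix_vector_right_distrib matrix_vector_mult_diff_distrib
        flip: matrix_vector_mul_assoc)
  have EP: "E ** P = P ** E"
  proof -
    have "E ** P = E ** (P ** A') ** E"
      by (simp add: E flip: matrix_mul_assoc)
    also have "\<dots> = E ** (A' ** P) ** E"
      using A'P by simp
    also have "\<dots> = P ** E"
      by (simp add: E matrix_mul_assoc)
    finally show ?thesis .
  qed
  have "blk_matrix b i (E ** P)"
    unfolding blk_matrix_iff P_def[symmetric] using EP PP by (metis matrix_mul_assoc)
  moreover have "E ** P ** A = P"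
    using A A'P E by (metis matrix_mul_assoc matrix_mul_lid)
  moreover have "A ** (E ** P) = P"
    using A A'P E EP PP by (metis matrix_mul_assoc matrix_mul_rid)
  ultimately have "blk_matrix b i (E ** P)" "blk_inv b i A = E ** P" "A ** (E ** P) = P"
    using blk_inv_unique[of b i "E ** P" A] by (simp_all add: P_def)
  then show "blk_matrix b i (blk_inv b i A)" "A ** blk_inv b i A = blk_id b i"
    by (simp_all add: P_def)
qed

section \<open>The weighted norms\<close>

definition blk_sq :: "('m::finite \<Rightarrow> 'n::finite) \<Rightarrow> ('n \<Rightarrow> real^'m^'m) \<Rightarrow> 'n \<Rightarrow> real^'m \<Rightarrow> real" where
  "blk_sq b B i x = (B i *v blk b i x) \<bullet> blk b i x"

lemma wnorm_sq_eq: "wnorm_sq b B w x = (\<Sum>i\<in>UNIV. w $ i * blk_sq b B i x)"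
  by (simp add: wnorm_sq_def blk_sq_def)

lemma blk_sq_cong: "blk b i x = blk b i y \<Longrightarrow> blk_sq b B i x = blk_sq b B i y"
  by (simp add: blk_sq_def)

lemma blk_sq_nonneg: "blk_pos_def b i (B i) \<Longrightarrow> 0 \<le> blk_sq b B i x"
  unfolding blk_pos_def_def blk_sq_def by (metis inner_zero_right less_eq_real_def)

lemma blk_sq_scaleR: "blk_sq b B i (c *\<^sub>R x) = c\<^sup>2 * blk_sq b B i x"
  by (simp add: blk_sq_def blk_scaleR matrix_vector_mult_scaleR power2_eq_square)

text \<open>
  Symmetry of \<open>B\<^sub>i\<close> merges the two cross terms.
\<close>

lemma blk_sq_add:
  assumes "blk_pos_def b i (B i)"
  shows "blk_sq b B i (x + y)
    = blk_sq b B i x + 2 * ((B i *v blk b i y) \<bullet> blk b i x) + blk_sq b B i y"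
proof -
  have "transpose (B i) = B i"
    using assms by (simp add: blk_pos_def_def)
  then have "(B i *v blk b i x) \<bullet> blk b i y = (B i *v blk b i y) \<bullet> blk b i x"
    by (metis dot_lmul_matrix inner_commute transpose_matrix_vector)
  then show ?thesis
    by (simp add: blk_sq_def blk_add matrix_vector_right_distrib inner_add_left inner_add_right)
qed

lemma expectation_if_mem:
  fixes Shat :: "'n::finite set pmf"
  shows "measure_pmf.expectation Shat (\<lambda>s. if i \<in> s then a else c)
    = (sampling_prob Shat $ i) * a + (1 - sampling_prob Shat $ i) * c"
proof -
  have "measure_pmf.expectation Shat (\<lambda>s. if i \<in> s then a else c)
      = measure_pmf.expectation Shat (\<lambda>s. c + indicator {s. i \<in> s} s * (a - c))"
    by (intro Bochner_Integration.integral_cong) auto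
  also have "\<dots> = c + measure_pmf.prob Shat {s. i \<in> s} * (a - c)"
    by (subst Bochner_Integration.integral_add) (auto intro!: integrable_measure_pmf_finite)
  finally show ?thesis
    by (simp add: sampling_prob_def algebra_simps)
qed

text \<open>
  Block \<open>i\<close> of \<open>u + d\<^bsub>[S]\<^esub>\<close> is that of \<open>u + d\<close> with probability \<open>p\<^sub>i\<close> and that of \<open>u\<close> otherwise, and the
  squared norm is a sum over blocks; so only the marginals \<open>p\<^sub>i\<close> of the sampling enter.
\<close>

lemma expectation_wnorm_sq_restrict:
  fixes Shat :: "'n::finite set pmf" and b :: "'m::finite \<Rightarrow> 'n"
  shows "measure_pmf.expectation Shat (\<lambda>s. wnorm_sq b B w (u + blk_restrict b s d))
    = (\<Sum>i\<in>UNIV. w $ i * ((sampling_prob Shat $ i) * blk_sq b B i (u + d)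
         + (1 - sampling_prob Shat $ i) * blk_sq b B i u))"
proof -
  have *: "blk_sq b B i (u + blk_restrict b s d)
      = (if i \<in> s then blk_sq b B i (u + d) else blk_sq b B i u)" for i s
    by (auto intro!: blk_sq_cong simp: blk_add blk_restrict_nth)
  show ?thesis
    unfolding wnorm_sq_eq *
    by (subst Bochner_Integration.integral_sum)
      (auto intro!: integrable_measure_pmf_finite simp: expectation_if_mem)
qed

section \<open>Gradients of convex functions\<close>

text \<open>
  The description operator in \<^const>\<open>grad\<close> denotes the Riesz representative of the derivative.
\<close>

lemma has_derivative_grad:
  fixes f :: "'a::euclidean_space \<Rightarrow> real"
  assumes "f differentiable (at x)"
  shows "(f has_derivative (\<lambda>h. h \<bullet> grad f x)) (at x)"
proof -
  obtain f' where f': "(f has_derivative f') (at x)"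
    using assms by (auto simp: differentiable_def)
  define D where "D = adjoint f' 1"
  have lin: "linear f'"
    using f' by (rule has_derivative_linear)
  have "f' h = h \<bullet> D" for h
    using adjoint_works[OF lin, of h 1] by (simp add: D_def)
  then have D: "GDERIV f x :> D"
    using f' unfolding gderiv_def by (metis (no_types, lifting) ext)
  moreover have "D' = D" if "GDERIV f x :> D'" for D'
  proof -
    have "(\<lambda>h. h \<bullet> D') = (\<lambda>h. h \<bullet> D)"
      using that D unfolding gderiv_def by (rule has_derivative_unique)
    then show ?thesis
      by (metis vector_eq_ldot)
  qed
  ultimately have "GDERIV f x :> grad f x"
    unfolding grad_def by (rule theI)
  then show ?thesis
    by (simp add: gderiv_def)
qed

text \<open>
  The one-dimensional tangent inequality along the segment from \<open>x\<close> to \<open>y\<close>.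
\<close>

lemma convex_grad_ineq:
  fixes f :: "'a::euclidean_space \<Rightarrow> real"
  assumes "convex_on UNIV f" "f differentiable (at x)"
  shows "f x + grad f x \<bullet> (y - x) \<le> f y"
proof -
  define g where "g t = f (x + t *\<^sub>R (y - x))" for t
  have conv: "convex_on UNIV g"
  proof (rule convex_onI)
    fix t a c :: real assume t: "0 < t" "t < 1"
    have "x + ((1 - t) *\<^sub>R a + t *\<^sub>R c) *\<^sub>R (y - x)
        = (1 - t) *\<^sub>R (x + a *\<^sub>R (y - x)) + t *\<^sub>R (x + c *\<^sub>R (y - x))"
      by (simp add: algebra_simps)
    then show "g ((1 - t) *\<^sub>R a + t *\<^sub>R c) \<le> (1 - t) * g a + t * g c"
      unfolding g_def using convex_onD[OF assms(1), of t] t by simp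
  qed simp
  have 1: "((\<lambda>t. x + t *\<^sub>R (y - x)) has_derivative (\<lambda>t. t *\<^sub>R (y - x))) (at 0)"
    by (auto intro!: derivative_eq_intros)
  have 2: "(f has_derivative (\<lambda>h. h \<bullet> grad f x)) (at (x + 0 *\<^sub>R (y - x)))"
    using has_derivative_grad[OF assms(2)] by simp
  have "(g has_derivative (\<lambda>t. (t *\<^sub>R (y - x)) \<bullet> grad f x)) (at 0)"
    unfolding g_def using has_derivative_compose[OF 1 2] .
  then have "(g has_field_derivative grad f x \<bullet> (y - x)) (at 0)"
    by (simp add: has_field_derivative_def inner_commute mult_commute_abs)
  then have "g 1 - g 0 \<ge> grad f x \<bullet> (y - x) * (1 - 0)"
    using conv by (intro convex_on_imp_above_tangent[where A = UNIV]) auto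
  then show ?thesis
    by (simp add: g_def)
qed

section \<open>One step of the algorithm\<close>

text \<open>
  The displacement of \<open>z\<close> for the gradient \<open>g\<close> when every block is drawn.
\<close>

definition ALPHA_dir ::
    "('m::finite \<Rightarrow> 'n::finite) \<Rightarrow> ('n \<Rightarrow> real^'m^'m) \<Rightarrow> real^'n \<Rightarrow> real^'n \<Rightarrow> real \<Rightarrow> real^'m \<Rightarrow> real^'m" where
  "ALPHA_dir b B p v \<theta> g = - (\<Sum>i\<in>UNIV. (p $ i / (v $ i * \<theta>)) *\<^sub>R (blk_inv b i (B i) *v blk b i g))"

lemma blk_ALPHA_dir:
  assumes B: "\<And>i. blk_pos_def b i (B i)"
  shows "blk b i (ALPHA_dir b B p v \<theta> g)
    = - (p $ i / (v $ i * \<theta>)) *\<^sub>R (blk_inv b i (B i) *v blk b i g)"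
proof -
  have "blk_id b l *v (blk_inv b l (B l) *v h) = blk_inv b l (B l) *v h" for l h
    using blk_inv_pos_def(1)[OF B] by (simp add: blk_matrix_iff matrix_vector_mul_assoc)
  then have *: "blk b i (blk_inv b l (B l) *v h) = (if i = l then blk_inv b i (B i) *v h else 0)" for l h
    by (metis blk_blk blk_id_vector)
  show ?thesis
    unfolding ALPHA_dir_def blk_minus blk_sum blk_scaleR *
    by (simp add: if_distrib[of "scaleR _"] blk_0 cong: if_cong)
qed

text \<open>
  The first-order optimality condition that makes the displacement the minimiser of the quadratic
  \<open>d \<mapsto> \<theta> \<langle>g, d\<rangle> + \<theta>\<^sup>2/2 \<parallel>d\<parallel>\<^sup>2\<close> with norm weights \<open>v \<circ> p\<^sup>-\<^sup>1\<close>.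
\<close>

lemma B_blk_ALPHA_dir:
  assumes B: "\<And>i. blk_pos_def b i (B i)"
  shows "B i *v blk b i (ALPHA_dir b B p v \<theta> g) = - (p $ i / (v $ i * \<theta>)) *\<^sub>R blk b i g"
proof -
  have "B i *v (blk_inv b i (B i) *v blk b i g) = blk b i g"
    using blk_inv_pos_def(2)[OF B] by (simp add: matrix_vector_mul_assoc blk_id_vector blk_blk)
  then show ?thesis
    by (simp only: blk_ALPHA_dir[OF B] matrix_vector_mult_scaleR)
qed

text \<open>
  On block \<open>i\<close>, this compares the minimal value of the quadratic, attained at \<open>d\<close>, with its value at \<open>-u\<close>.
  A quadratic exceeds its minimum by exactly its homogeneous part evaluated at the distance to the
  minimiser, which is why equality holds.  It is used with \<open>u = z - y\<close>.
\<close>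

lemma ALPHA_dir_three_point:
  fixes b :: "'m::finite \<Rightarrow> 'n::finite" and g :: "real^'m"
  assumes B: "\<And>i. blk_pos_def b i (B i)"
    and pos: "0 < p $ i" "0 < v $ i" "0 < \<theta>"
  defines "d \<equiv> ALPHA_dir b B p v \<theta> g"
  shows "\<theta> * (blk b i g \<bullet> blk b i d) + \<theta>\<^sup>2 / 2 * (v $ i / p $ i) * blk_sq b B i d
    = - \<theta> * (blk b i g \<bullet> blk b i u)
      + \<theta>\<^sup>2 / 2 * (v $ i / p $ i) * (blk_sq b B i u - blk_sq b B i (u + d))"
proof -
  have sq: "blk_sq b B i d = - (p $ i / (v $ i * \<theta>)) * (blk b i g \<bullet> blk b i d)"
    by (simp add: blk_sq_def d_def B_blk_ALPHA_dir[OF B])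
  have sq_add: "blk_sq b B i (u + d) = blk_sq b B i u
      - 2 * (p $ i / (v $ i * \<theta>)) * (blk b i g \<bullet> blk b i u) + blk_sq b B i d"
    by (simp add: blk_sq_add[OF B] d_def B_blk_ALPHA_dir[OF B])
  show ?thesis
    unfolding sq_add sq using pos by (simp add: field_simps power2_eq_square)
qed

text \<open>
  The estimate for a single random step from fixed \<open>x\<close> and \<open>z\<close>: the ESO bounds the mean of \<open>f\<close> by the
  quadratic minimised by \<open>d\<close>, the three-point identity replaces \<open>d\<close> by \<open>y - z\<close> at the cost of the
  change in distance to \<open>y\<close>, and convexity at \<open>u\<close> bounds \<open>f u + \<theta> \<langle>\<nabla>f u, y - z\<rangle>\<close>.
\<close>

lemma ALPHA_step_expectation:
  fixes b :: "'m::finite \<Rightarrow> 'n::finite" and x z y :: "real^'m" and f :: "real^'m \<Rightarrow> real"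
  assumes B: "\<And>i. blk_pos_def b i (B i)"
    and f_convex: "convex_on UNIV f"
    and f_diff: "\<And>x. f differentiable (at x)"
    and p_pos: "\<And>i. 0 < sampling_prob Shat $ i"
    and v_pos: "\<And>i. 0 < v $ i"
    and eso: "ESO b B f Shat v"
    and \<theta>: "0 < \<theta>" "\<theta> \<le> 1"
  defines "p \<equiv> sampling_prob Shat"
  defines "u \<equiv> (1 - \<theta>) *\<^sub>R x + \<theta> *\<^sub>R z"
  defines "d \<equiv> ALPHA_dir b B p v \<theta> (grad f u)"
  defines "w \<equiv> v \<circ>\<^sub>v vpowi p (-2)"
  shows "measure_pmf.expectation Shat
      (\<lambda>s. f (u + \<theta> *\<^sub>R blk_scale b (vpowi p (-1)) (blk_restrict b s d)))
    + \<theta>\<^sup>2 / 2 * measure_pmf.expectation Shat (\<lambda>s. wnorm_sq b B w (z + blk_restrict b s d - y))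
    \<le> (1 - \<theta>) * f x + \<theta> * f y + \<theta>\<^sup>2 / 2 * wnorm_sq b B w (z - y)"
proof -
  define g where "g = grad f u"
  define h where "h = \<theta> *\<^sub>R blk_scale b (vpowi p (-1)) d"
  have p: "0 < p $ i" for i
    using p_pos by (simp add: p_def)
  \<comment> \<open>\<open>h\<close> is the ESO argument; its factor \<open>\<theta> / p\<^sub>i\<close> cancels the weight \<open>p\<^sub>i\<close> of the linear term and
      turns the weight \<open>v\<^sub>i p\<^sub>i\<close> of the quadratic term into \<open>\<theta>\<^sup>2 v\<^sub>i / p\<^sub>i\<close>\<close>
  have blk_h: "blk b i h = (\<theta> / p $ i) *\<^sub>R blk b i d" for i
    by (simp add: h_def blk_scaleR blk_scale_nth vpowi_def power_int_minus divide_inverse)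
  have blk_sq_h: "blk_sq b B i h = (\<theta> / p $ i)\<^sup>2 * blk_sq b B i d" for i
    by (subst blk_sq_scaleR[symmetric], rule blk_sq_cong) (simp add: blk_h blk_scaleR)
  have h_restrict: "\<theta> *\<^sub>R blk_scale b (vpowi p (-1)) (blk_restrict b s d) = blk_restrict b s h" for s
    by (rule blk_eqI[of b]) (simp add: h_def blk_scaleR blk_scale_nth blk_restrict_nth)
  have w: "w $ i = v $ i / (p $ i)\<^sup>2" for i
    by (simp add: w_def vmult_def vpowi_def power_int_minus divide_inverse)
  have "measure_pmf.expectation Shat (\<lambda>s. f (u + blk_restrict b s h))
      \<le> f u + winner b p g h + 1/2 * wnorm_sq b B (v \<circ>\<^sub>v p) h"
    using eso unfolding ESO_def p_def g_def by blast
  also have "winner b p g h = (\<Sum>i\<in>UNIV. \<theta> * (blk b i g \<bullet> blk b i d))"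
    unfolding winner_def by (rule sum.cong) (use p in \<open>auto simp: blk_h less_imp_neq[symmetric]\<close>)
  also have "1/2 * wnorm_sq b B (v \<circ>\<^sub>v p) h
      = (\<Sum>i\<in>UNIV. \<theta>\<^sup>2 / 2 * (v $ i / p $ i) * blk_sq b B i d)"
    unfolding wnorm_sq_eq sum_distrib_left
    by (rule sum.cong) (use p in \<open>auto simp: blk_sq_h vmult_def power2_eq_square field_simps less_imp_neq[symmetric]\<close>)
  finally have "measure_pmf.expectation Shat (\<lambda>s. f (u + blk_restrict b s h))
      \<le> f u + (\<Sum>i\<in>UNIV. \<theta> * (blk b i g \<bullet> blk b i d)
          + \<theta>\<^sup>2 / 2 * (v $ i / p $ i) * blk_sq b B i d)"
    by (simp add: sum.distrib)
  also have "(\<Sum>i\<in>UNIV. \<theta> * (blk b i g \<bullet> blk b i d) + \<theta>\<^sup>2 / 2 * (v $ i / p $ i) * blk_sq b B i d)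
      = (\<Sum>i\<in>UNIV. - \<theta> * (blk b i g \<bullet> blk b i (z - y))
      + \<theta>\<^sup>2 / 2 * (v $ i / p $ i) * (blk_sq b B i (z - y) - blk_sq b B i (z - y + d)))"
    unfolding d_def g_def[symmetric]
    by (rule sum.cong[OF refl ALPHA_dir_three_point[OF B p v_pos \<theta>(1)]])
  also have "\<dots> = \<theta> * (g \<bullet> (y - z)) + (\<Sum>i\<in>UNIV. \<theta>\<^sup>2 / 2 * (v $ i / p $ i)
      * (blk_sq b B i (z - y) - blk_sq b B i (z - y + d)))"
    unfolding sum.distrib sum_distrib_left[symmetric] inner_eq_sum_blk[of g z b, symmetric]
      inner_eq_sum_blk[of g "z - y" b, symmetric] by (simp add: algebra_simps inner_diff_right)
  \<comment> \<open>since \<open>w\<^sub>i p\<^sub>i = v\<^sub>i / p\<^sub>i\<close>, the expected decrease of the \<open>w\<close>-norm under the random move is the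
      decrease of the \<open>v \<circ> p\<^sup>-\<^sup>1\<close>-norm under the full move\<close>
  also have "(\<Sum>i\<in>UNIV. \<theta>\<^sup>2 / 2 * (v $ i / p $ i) * (blk_sq b B i (z - y) - blk_sq b B i (z - y + d)))
      = \<theta>\<^sup>2 / 2 * wnorm_sq b B w (z - y)
        - \<theta>\<^sup>2 / 2 * measure_pmf.expectation Shat (\<lambda>s. wnorm_sq b B w (z - y + blk_restrict b s d))"
    unfolding expectation_wnorm_sq_restrict unfolding p_def[symmetric]
    unfolding wnorm_sq_eq sum_distrib_left sum_subtractf[symmetric]
    by (rule sum.cong) (use p in \<open>auto simp: w power2_eq_square field_simps less_imp_neq[symmetric]\<close>)
  finally have main: "measure_pmf.expectation Shat (\<lambda>s. f (u + blk_restrict b s h))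
      + \<theta>\<^sup>2 / 2 * measure_pmf.expectation Shat (\<lambda>s. wnorm_sq b B w (z - y + blk_restrict b s d))
      \<le> f u + \<theta> * (g \<bullet> (y - z)) + \<theta>\<^sup>2 / 2 * wnorm_sq b B w (z - y)"
    by linarith
  have "f u + \<theta> * (g \<bullet> (y - z)) \<le> (1 - \<theta>) * f x + \<theta> * f y"
  proof -
    \<comment> \<open>the choice of \<open>u\<close> as a convex combination of \<open>x\<close> and \<open>z\<close> eliminates \<open>z\<close>\<close>
    have "\<theta> *\<^sub>R (y - z) = \<theta> *\<^sub>R (y - u) + (1 - \<theta>) *\<^sub>R (x - u)"
      by (simp add: u_def algebra_simps)
    then have "\<theta> * (g \<bullet> (y - z)) = \<theta> * (g \<bullet> (y - u)) + (1 - \<theta>) * (g \<bullet> (x - u))"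
      by (metis inner_add_right inner_scaleR_right)
    moreover have "\<theta> * (f u + g \<bullet> (y - u)) \<le> \<theta> * f y"
      using convex_grad_ineq[OF f_convex f_diff] \<theta> by (intro mult_left_mono) (auto simp: g_def)
    moreover have "(1 - \<theta>) * (f u + g \<bullet> (x - u)) \<le> (1 - \<theta>) * f x"
      using convex_grad_ineq[OF f_convex f_diff] \<theta> by (intro mult_left_mono) (auto simp: g_def)
    ultimately show ?thesis
      by (simp add: algebra_simps)
  qed
  with main show ?thesis
    unfolding h_restrict by (simp add: algebra_simps)
qed

section \<open>The iterates as functions of the sets drawn\<close>

text \<open>
  The pair \<open>(x\<^sub>k, z\<^sub>k)\<close> as an explicit function of the sets drawn.  The relational description of the
  algorithm fixes \<open>z\<close> block by block; the recursion exhibits that the \<open>k\<close>-th pair depends on the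
  first \<open>k\<close> draws only, which is what measurability and independence rest on.
\<close>

primrec ALPHA_iter ::
    "('m::finite \<Rightarrow> 'n::finite) \<Rightarrow> ('n \<Rightarrow> real^'m^'m) \<Rightarrow> (real^'m \<Rightarrow> real) \<Rightarrow> real^'n \<Rightarrow> real^'n \<Rightarrow>
     real \<Rightarrow> real^'m \<Rightarrow> (nat \<Rightarrow> 'n set) \<Rightarrow> nat \<Rightarrow> (real^'m) \<times> (real^'m)" where
  "ALPHA_iter b B f p v \<theta> x0 s 0 = (x0, x0)"
| "ALPHA_iter b B f p v \<theta> x0 s (Suc k) =
    (let (x, z) = ALPHA_iter b B f p v \<theta> x0 s k;
         u = (1 - \<theta>) *\<^sub>R x + \<theta> *\<^sub>R z;
         e = blk_restrict b (s k) (ALPHA_dir b B p v \<theta> (grad f u))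
     in (u + \<theta> *\<^sub>R blk_scale b (vpowi p (-1)) e, z + e))"

lemma smooth_ALPHA_iter:
  assumes B: "\<And>i. blk_pos_def b i (B i)"
    and run: "smooth_ALPHA b B f p v (\<lambda>_. \<theta>) x0 s x y z"
  shows "ALPHA_iter b B f p v \<theta> x0 s k = (x k, z k)"
proof (induction k)
  case 0
  then show ?case using run by (simp add: smooth_ALPHA_def)
next
  case (Suc k)
  define e where "e = blk_restrict b (s k) (ALPHA_dir b B p v \<theta> (grad f (y k)))"
  have y: "y k = (1 - \<theta>) *\<^sub>R x k + \<theta> *\<^sub>R z k"
    and z_in: "i \<in> s k \<Longrightarrow> blk b i (z (Suc k)) =
          blk b i (z k) - (p $ i / (v $ i * \<theta>)) *\<^sub>R (blk_inv b i (B i) *v blk b i (grad f (y k)))"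
    and z_notin: "i \<notin> s k \<Longrightarrow> blk b i (z (Suc k)) = blk b i (z k)"
    and x: "x (Suc k) = y k + \<theta> *\<^sub>R blk_scale b (vpowi p (-1)) (z (Suc k) - z k)" for i
    using run unfolding smooth_ALPHA_def by blast+
  have "z (Suc k) = z k + e"
    by (rule blk_eqI[of b])
      (auto simp: e_def blk_add blk_restrict_nth blk_ALPHA_dir[OF B] z_in z_notin)
  then show ?case
    using Suc x by (simp add: Let_def y[symmetric] e_def[symmetric])
qed

lemma ALPHA_iter_cong:
  "(\<And>l. l < k \<Longrightarrow> s l = s' l) \<Longrightarrow> ALPHA_iter b B f p v \<theta> x0 s k = ALPHA_iter b B f p v \<theta> x0 s' k"
  by (induction k) auto

section \<open>Expectations over the past draws\<close>

text \<open>
  Finitely many draws of subsets of a finite set have finitely many outcomes, so their joint law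
  lives on a finite discrete space, where every function is measurable and bounded.
\<close>

lemma measurable_restrict_draws:
  fixes S :: "nat \<Rightarrow> 'w \<Rightarrow> 'n::finite set"
  assumes "\<And>k. S k \<in> measurable M (count_space UNIV)"
  shows "(\<lambda>\<omega>. \<lambda>i\<in>{..<k}. S i \<omega>) \<in> measurable M (count_space ({..<k} \<rightarrow>\<^sub>E UNIV))"
proof -
  have "(\<lambda>\<omega>. \<lambda>i\<in>{..<k}. S i \<omega>) \<in> measurable M (PiM {..<k} (\<lambda>_. count_space UNIV))"
    by (intro measurable_restrict assms)
  then show ?thesis
    by (subst (asm) count_space_PiM_finite) auto
qed

context prob_space
begin

lemma integrable_past:
  fixes S :: "nat \<Rightarrow> 'a \<Rightarrow> 'n::finite set" and F :: "(nat \<Rightarrow> 'n set) \<Rightarrow> real"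
  assumes meas: "\<And>k. S k \<in> measurable M (count_space UNIV)"
    and F: "\<And>\<omega>. \<omega> \<in> space M \<Longrightarrow> X \<omega> = F (\<lambda>i\<in>{..<k}. S i \<omega>)"
  shows "integrable M X"
proof -
  have fin: "finite ({..<k} \<rightarrow>\<^sub>E (UNIV :: 'n set set))"
    by (intro finite_PiE) auto
  have mem: "(\<lambda>i\<in>{..<k}. S i \<omega>) \<in> {..<k} \<rightarrow>\<^sub>E UNIV" for \<omega>
    by auto
  have "integrable M (\<lambda>\<omega>. F (\<lambda>i\<in>{..<k}. S i \<omega>))"
  proof (rule integrable_const_bound)
    show "AE \<omega> in M. norm (F (\<lambda>i\<in>{..<k}. S i \<omega>))
        \<le> Max ((\<lambda>h. norm (F h)) ` ({..<k} \<rightarrow>\<^sub>E UNIV))"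
      using fin mem by (intro AE_I2 Max_ge finite_imageI imageI) auto
    show "(\<lambda>\<omega>. F (\<lambda>i\<in>{..<k}. S i \<omega>)) \<in> borel_measurable M"
      using measurable_restrict_draws[OF meas] by (rule measurable_compose) simp
  qed
  then show ?thesis
    using F by (subst Bochner_Integration.integrable_cong[OF refl]) auto
qed

text \<open>
  Fubini's theorem for the past draws and the current one.  Splitting over the finitely many values
  \<open>t\<close> of the current draw reduces it to the product rule for the expectations of the independent
  variables \<open>F(past, t)\<close> and the indicator of \<open>S\<^sub>k = t\<close>.
\<close>

lemma expectation_past_present:
  fixes S :: "nat \<Rightarrow> 'a \<Rightarrow> 'n::finite set" and F :: "(nat \<Rightarrow> 'n set) \<Rightarrow> 'n set \<Rightarrow> real"
  assumes indep: "indep_vars (\<lambda>_. count_space UNIV) S UNIV"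
    and distr: "distr M (count_space UNIV) (S k) = measure_pmf Shat"
  shows "expectation (\<lambda>\<omega>. F (\<lambda>i\<in>{..<k}. S i \<omega>) (S k \<omega>))
    = expectation (\<lambda>\<omega>. measure_pmf.expectation Shat (F (\<lambda>i\<in>{..<k}. S i \<omega>)))"
proof -
  define H where "H = (\<lambda>\<omega>. \<lambda>i\<in>{..<k}. S i \<omega>)"
  have meas: "S j \<in> measurable M (count_space UNIV)" for j
    using indep by (simp add: indep_vars_def)
  have indep_t: "indep_var borel (\<lambda>\<omega>. F (H \<omega>) t) borel (\<lambda>\<omega>. indicator {t} (S k \<omega>) :: real)" for t
  proof -
    have "indep_var (PiM {..<k} (\<lambda>_. count_space UNIV)) H
        (PiM {k} (\<lambda>_. count_space UNIV)) (\<lambda>\<omega>. \<lambda>i\<in>{k}. S i \<omega>)"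
      unfolding H_def by (rule indep_var_restrict[OF indep]) auto
    then have "indep_var (count_space ({..<k} \<rightarrow>\<^sub>E UNIV)) H
        (PiM {k} (\<lambda>_. count_space UNIV)) (\<lambda>\<omega>. \<lambda>i\<in>{k}. S i \<omega>)"
      by (subst (asm) count_space_PiM_finite) auto
    then have "indep_var borel ((\<lambda>h. F h t) \<circ> H)
        borel ((\<lambda>h. indicator {t} (h k) :: real) \<circ> (\<lambda>\<omega>. \<lambda>i\<in>{k}. S i \<omega>))"
    proof (rule indep_var_compose)
      have "(\<lambda>h. h k) \<in> measurable (PiM {k} (\<lambda>_. count_space UNIV)) (count_space UNIV)"
        by (rule measurable_component_singleton) simp
      then show "(\<lambda>h. indicator {t} (h k) :: real) \<in> borel_measurable (PiM {k} (\<lambda>_. count_space UNIV))"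
        by (rule measurable_compose) simp
    qed simp
    then show ?thesis
      by (simp add: comp_def)
  qed
  have int1: "integrable M (\<lambda>\<omega>. F (H \<omega>) t)" for t
    by (rule integrable_past[of S _ "\<lambda>h. F h t" k, OF meas]) (simp add: H_def)
  have int2: "integrable M (\<lambda>\<omega>. indicator {t} (S k \<omega>) :: real)" for t
    using meas[of k] by (intro integrable_const_bound[of _ 1] AE_I2)
      (auto intro: measurable_compose split: split_indicator)
  have law: "expectation (\<lambda>\<omega>. indicator {t} (S k \<omega>)) = pmf Shat t" for t
  proof -
    have "expectation (\<lambda>\<omega>. indicator {t} (S k \<omega>)) = measure_pmf.expectation Shat (indicat_real {t})"
      unfolding distr[symmetric] by (subst integral_distr[OF meas]) auto
    then show ?thesis
      by (simp add: pmf.rep_eq)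
  qed
  have "expectation (\<lambda>\<omega>. F (H \<omega>) (S k \<omega>))
      = expectation (\<lambda>\<omega>. \<Sum>t\<in>UNIV. F (H \<omega>) t * indicator {t} (S k \<omega>))"
    by (simp add: indicator_def if_distrib cong: if_cong)
  also have "\<dots> = (\<Sum>t\<in>UNIV. expectation (\<lambda>\<omega>. F (H \<omega>) t * indicator {t} (S k \<omega>)))"
    by (intro Bochner_Integration.integral_sum indep_var_integrable indep_t int1 int2)
  also have "\<dots> = (\<Sum>t\<in>UNIV. expectation (\<lambda>\<omega>. F (H \<omega>) t) * pmf Shat t)"
    by (subst indep_var_lebesgue_integral[OF indep_t int1 int2]) (simp add: law)
  also have "\<dots> = expectation (\<lambda>\<omega>. \<Sum>t\<in>UNIV. F (H \<omega>) t * pmf Shat t)"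
    using int1 by simp
  also have "\<dots> = expectation (\<lambda>\<omega>. measure_pmf.expectation Shat (F (H \<omega>)))"
    by (subst integral_measure_pmf_real[of UNIV]) auto
  finally show ?thesis
    by (simp add: H_def)
qed

end

section \<open>From one step to the rate\<close>

text \<open>
  Telescoping: the terms \<open>r\<close> reduce to \<open>r\<^sub>0 - r\<^sub>k \<le> r\<^sub>0\<close>, and each \<open>a\<^sub>l\<close> with \<open>0 < l < k\<close> occurs with weight \<open>1\<close> on the left and
  \<open>1 - \<theta>\<close> on the right, hence with net weight \<open>\<theta>\<close>.
\<close>

lemma sum_recursion_bound:
  fixes a r :: "nat \<Rightarrow> real"
  assumes step: "\<And>k. a (Suc k) + r (Suc k) \<le> (1 - \<theta>) * a k + r k"
    and r: "\<And>k. 0 \<le> r k" and k: "1 \<le> k"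
  shows "a k + \<theta> * (\<Sum>l=1..k-1. a l) \<le> (1 - \<theta>) * a 0 + r 0"
proof -
  have "a (Suc j) + r (Suc j) + \<theta> * (\<Sum>l=1..j. a l) \<le> (1 - \<theta>) * a 0 + r 0" for j
  proof (induction j)
    case 0
    then show ?case using step[of 0] by simp
  next
    case (Suc j)
    then show ?case using step[of "Suc j"] by (simp add: algebra_simps)
  qed
  from this[of "k - 1"] r[of k] k show ?thesis by simp
qed

text \<open>
  Jensen's inequality: the averaged iterate is a convex combination of \<open>x\<^sub>1, \<dots>, x\<^sub>k\<close>, with weights
  proportional to \<open>\<theta>, \<dots>, \<theta>, 1\<close>.
\<close>

lemma convex_ALPHA_average:
  assumes f: "convex_on UNIV f" and \<theta>: "0 < \<theta>" and k: "1 \<le> k"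
  shows "f (ALPHA_average \<theta> x k)
    \<le> (f (x k) + \<theta> * (\<Sum>l=1..k-1. f (x l))) / (1 + (real k - 1) * \<theta>)"
proof -
  define W where "W = 1 + (real k - 1) * \<theta>"
  define c where "c l = (if l = k then 1 else \<theta>) / W" for l
  have W: "0 < W"
    using \<theta> k by (simp add: W_def add_pos_nonneg)
  have split: "{1..k} = insert k {1..k-1}" "k \<notin> {1..k-1}"
    using k by auto
  have c_last: "c k = 1 / W"
    by (simp add: c_def)
  have c_rest: "c l = \<theta> / W" if "l \<in> {1..k-1}" for l
    using that by (auto simp: c_def)
  have "sum c {1..k-1} = (\<Sum>l=1..k-1. \<theta> / W)"
    by (rule sum.cong[OF refl c_rest])
  then have "sum c {1..k} = (1 + (real k - 1) * \<theta>) / W"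
    unfolding split(1) using k by (simp add: c_last of_nat_diff add_divide_distrib)
  then have c1: "sum c {1..k} = 1"
    using W by (simp add: W_def)
  have "(\<Sum>l=1..k-1. c l *\<^sub>R x l) = (\<Sum>l=1..k-1. (\<theta> / W) *\<^sub>R x l)"
    by (rule sum.cong) (simp_all only: c_rest)
  then have "ALPHA_average \<theta> x k = (\<Sum>l\<in>{1..k}. c l *\<^sub>R x l)"
    unfolding split(1) using split(2)
    by (simp add: ALPHA_average_def c_last W_def[symmetric] scaleR_sum_right scaleR_add_right)
  also have "f \<dots> \<le> (\<Sum>l\<in>{1..k}. c l * f (x l))"
    using c1 \<theta> W k by (intro convex_on_sum[OF _ _ f]) (auto simp: c_def)
  also have "\<dots> = (f (x k) + \<theta> * (\<Sum>l=1..k-1. f (x l))) / W"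
  proof -
    have "(\<Sum>l=1..k-1. c l * f (x l)) = (\<Sum>l=1..k-1. (\<theta> / W) * f (x l))"
      by (rule sum.cong) (simp_all only: c_rest)
    then show ?thesis
      unfolding split(1) using split(2)
      by (simp add: c_last add_divide_distrib sum_distrib_left sum_divide_distrib)
  qed
  finally show ?thesis
    by (simp add: W_def)
qed

lemma Min_le_weighted_average:
  fixes e :: "nat \<Rightarrow> real"
  assumes "0 < \<theta>" "1 \<le> k"
  shows "(MIN l\<in>{1..k}. e l) \<le> (e k + \<theta> * (\<Sum>l=1..k-1. e l)) / (1 + (real k - 1) * \<theta>)"
proof -
  define m where "m = (MIN l\<in>{1..k}. e l)"
  have m: "m \<le> e l" if "l \<in> {1..k}" for l
    unfolding m_def using that by (intro Min_le) auto
  have "(\<Sum>l=1..k-1. m) \<le> (\<Sum>l=1..k-1. e l)"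
    by (intro sum_mono m) auto
  then have "(real k - 1) * m \<le> (\<Sum>l=1..k-1. e l)"
    using assms by (simp add: of_nat_diff)
  then have "\<theta> * ((real k - 1) * m) \<le> \<theta> * (\<Sum>l=1..k-1. e l)"
    using assms by (intro mult_left_mono) auto
  moreover have "m \<le> e k"
    using assms by (intro m) auto
  moreover have "0 < 1 + (real k - 1) * \<theta>"
    using assms by (simp add: add_pos_nonneg)
  ultimately show ?thesis
    unfolding m_def[symmetric] by (simp add: pos_le_divide_eq algebra_simps)
qed

text \<open>
  The one-step estimate, averaged over the past draws.
\<close>

lemma smooth_ALPHA_expectation_recursion:
  fixes b :: "'m::finite \<Rightarrow> 'n::finite" and f :: "real^'m \<Rightarrow> real"
    and S :: "nat \<Rightarrow> 'w \<Rightarrow> 'n set" and xs ys zs :: "nat \<Rightarrow> 'w \<Rightarrow> real^'m"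
  assumes B: "\<And>i. blk_pos_def b i (B i)"
    and f_convex: "convex_on UNIV f"
    and f_diff: "\<And>x. f differentiable (at x)"
    and proper: "proper_sampling Shat"
    and p: "p = sampling_prob Shat"
    and v_pos: "\<And>i. 0 < v $ i"
    and eso: "ESO b B f Shat v"
    and \<theta>: "0 < \<theta>" "\<theta> \<le> 1"
    and M: "prob_space M"
    and S_indep: "prob_space.indep_vars M (\<lambda>_. count_space UNIV) S UNIV"
    and S_distr: "distr M (count_space UNIV) (S k) = measure_pmf Shat"
    and run: "\<And>\<omega>. \<omega> \<in> space M \<Longrightarrow>
      smooth_ALPHA b B f p v (\<lambda>_. \<theta>) x0 (\<lambda>k. S k \<omega>) (\<lambda>k. xs k \<omega>) (\<lambda>k. ys k \<omega>) (\<lambda>k. zs k \<omega>)"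
  defines "w \<equiv> v \<circ>\<^sub>v vpowi p (-2)"
  shows "(\<integral>\<omega>. f (xs (Suc k) \<omega>) \<partial>M) + \<theta>\<^sup>2 / 2 * (\<integral>\<omega>. wnorm_sq b B w (zs (Suc k) \<omega> - y) \<partial>M)
    \<le> (1 - \<theta>) * (\<integral>\<omega>. f (xs k \<omega>) \<partial>M) + \<theta> * f y
      + \<theta>\<^sup>2 / 2 * (\<integral>\<omega>. wnorm_sq b B w (zs k \<omega> - y) \<partial>M)"
proof -
  interpret prob_space M by (rule M)
  have meas: "S j \<in> measurable M (count_space UNIV)" for j
    using S_indep by (simp add: indep_vars_def)
  define A where "A s j = ALPHA_iter b B f p v \<theta> x0 s j" for s j
  define H where "H \<omega> = (\<lambda>i\<in>{..<k}. S i \<omega>)" for \<omega>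
  define u where "u h = (1 - \<theta>) *\<^sub>R fst (A h k) + \<theta> *\<^sub>R snd (A h k)" for h
  define e where "e h t = blk_restrict b t (ALPHA_dir b B p v \<theta> (grad f (u h)))" for h t
  define F where "F h t = f (u h + \<theta> *\<^sub>R blk_scale b (vpowi p (-1)) (e h t))" for h t
  define R where "R h t = wnorm_sq b B w (snd (A h k) + e h t - y)" for h t
  have AH: "A (H \<omega>) k = A (\<lambda>j. S j \<omega>) k" for \<omega>
    unfolding A_def by (rule ALPHA_iter_cong) (simp add: H_def)
  have A: "A (\<lambda>j. S j \<omega>) j = (xs j \<omega>, zs j \<omega>)" if "\<omega> \<in> space M" for \<omega> j
    unfolding A_def by (rule smooth_ALPHA_iter[OF B run[OF that]])
  have Suc_eq: "f (xs (Suc k) \<omega>) = F (H \<omega>) (S k \<omega>)"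
      "wnorm_sq b B w (zs (Suc k) \<omega> - y) = R (H \<omega>) (S k \<omega>)" if "\<omega> \<in> space M" for \<omega>
    using A[OF that, of "Suc k"] A[OF that, of k]
    by (simp_all add: F_def R_def e_def u_def AH) (simp_all add: A_def Let_def split_beta)
  have int: "integrable M (\<lambda>\<omega>. G (H \<omega>))" for G :: "(nat \<Rightarrow> 'n set) \<Rightarrow> real"
    by (rule integrable_past[of S _ G k, OF meas]) (simp add: H_def)
  have int_x: "integrable M (\<lambda>\<omega>. f (xs k \<omega>))"
    by (rule integrable_past[of S _ "\<lambda>h. f (fst (A h k))" k, OF meas])
      (simp add: H_def[symmetric] AH A)
  have int_z: "integrable M (\<lambda>\<omega>. wnorm_sq b B w (zs k \<omega> - y))"
    by (rule integrable_past[of S _ "\<lambda>h. wnorm_sq b B w (snd (A h k) - y)" k, OF meas])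
      (simp add: H_def[symmetric] AH A)
  have "(\<integral>\<omega>. f (xs (Suc k) \<omega>) \<partial>M) + \<theta>\<^sup>2 / 2 * (\<integral>\<omega>. wnorm_sq b B w (zs (Suc k) \<omega> - y) \<partial>M)
      = (\<integral>\<omega>. F (H \<omega>) (S k \<omega>) \<partial>M) + \<theta>\<^sup>2 / 2 * (\<integral>\<omega>. R (H \<omega>) (S k \<omega>) \<partial>M)"
    using Suc_eq by (simp cong: Bochner_Integration.integral_cong)
  also have "\<dots> = (\<integral>\<omega>. measure_pmf.expectation Shat (F (H \<omega>)) \<partial>M)
      + \<theta>\<^sup>2 / 2 * (\<integral>\<omega>. measure_pmf.expectation Shat (R (H \<omega>)) \<partial>M)"
    unfolding H_def
    by (simp only: expectation_past_present[OF S_indep S_distr, where F = F]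
        expectation_past_present[OF S_indep S_distr, where F = R])
  also have "\<dots> = (\<integral>\<omega>. measure_pmf.expectation Shat (F (H \<omega>))
      + \<theta>\<^sup>2 / 2 * measure_pmf.expectation Shat (R (H \<omega>)) \<partial>M)"
    using int[of "\<lambda>h. measure_pmf.expectation Shat (F h)"]
      int[of "\<lambda>h. measure_pmf.expectation Shat (R h)"] by simp
  also have "\<dots> \<le> (\<integral>\<omega>. (1 - \<theta>) * f (xs k \<omega>) + \<theta> * f y
      + \<theta>\<^sup>2 / 2 * wnorm_sq b B w (zs k \<omega> - y) \<partial>M)"
  proof (rule integral_mono)
    show "integrable M (\<lambda>\<omega>. measure_pmf.expectation Shat (F (H \<omega>))
        + \<theta>\<^sup>2 / 2 * measure_pmf.expectation Shat (R (H \<omega>)))"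
      by (rule int)
    show "integrable M (\<lambda>\<omega>. (1 - \<theta>) * f (xs k \<omega>) + \<theta> * f y
      + \<theta>\<^sup>2 / 2 * wnorm_sq b B w (zs k \<omega> - y))"
      using int_x int_z by simp
    have p_pos: "0 < sampling_prob Shat $ i" for i
      using proper by (simp add: proper_sampling_def)
    fix \<omega> assume \<omega>: "\<omega> \<in> space M"
    show "measure_pmf.expectation Shat (F (H \<omega>))
        + \<theta>\<^sup>2 / 2 * measure_pmf.expectation Shat (R (H \<omega>))
      \<le> (1 - \<theta>) * f (xs k \<omega>) + \<theta> * f y + \<theta>\<^sup>2 / 2 * wnorm_sq b B w (zs k \<omega> - y)"
      using ALPHA_step_expectation[OF B f_convex f_diff p_pos v_pos eso \<theta>,
          of "xs k \<omega>" "zs k \<omega>" y]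
      by (simp add: F_def[abs_def] R_def[abs_def] e_def u_def AH A[OF \<omega>] p w_def)
  qed
  also have "\<dots> = (1 - \<theta>) * (\<integral>\<omega>. f (xs k \<omega>) \<partial>M) + \<theta> * f y
      + \<theta>\<^sup>2 / 2 * (\<integral>\<omega>. wnorm_sq b B w (zs k \<omega> - y) \<partial>M)"
    using int_x int_z by (simp add: prob_space)
  finally show ?thesis .
qed

theorem theorem1:
  fixes b :: "'m::finite \<Rightarrow> 'n::finite"
    and B :: "'n \<Rightarrow> real^'m^'m"
    and f :: "real^'m \<Rightarrow> real"
    and Shat :: "'n set pmf"
    and p v :: "real^'n"
    and \<theta>\<^sub>0 :: real
    and M :: "'w measure"
    and S :: "nat \<Rightarrow> 'w \<Rightarrow> 'n set"
    and x0 y :: "real^'m"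
    and xs ys zs :: "nat \<Rightarrow> 'w \<Rightarrow> real^'m"
  assumes B: "\<And>i. blk_pos_def b i (B i)"
    and f_convex: "convex_on UNIV f"
    and f_diff: "\<And>x. f differentiable (at x)"
    and proper: "proper_sampling Shat"
    and p: "p = sampling_prob Shat"
    and v_pos: "\<And>i. 0 < v $ i"
    and eso: "ESO b B f Shat v"
    and \<theta>\<^sub>0: "0 < \<theta>\<^sub>0" "\<theta>\<^sub>0 \<le> 1"
    and M: "prob_space M"
    and S_indep: "prob_space.indep_vars M (\<lambda>_. count_space UNIV) S UNIV"
    and S_distr: "\<And>k. distr M (count_space UNIV) (S k) = measure_pmf Shat"
    and run: "\<And>\<omega>. \<omega> \<in> space M \<Longrightarrow>
      smooth_ALPHA b B f p v (\<lambda>_. \<theta>\<^sub>0) x0 (\<lambda>k. S k \<omega>) (\<lambda>k. xs k \<omega>) (\<lambda>k. ys k \<omega>) (\<lambda>k. zs k \<omega>)"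
  shows
    "(\<forall>k\<ge>1.
       max (\<integral>\<omega>. f (ALPHA_average \<theta>\<^sub>0 (\<lambda>l. xs l \<omega>) k) \<partial>M) (MIN l\<in>{1..k}. \<integral>\<omega>. f (xs l \<omega>) \<partial>M) - f y
       \<le> ((1 - \<theta>\<^sub>0) * (f x0 - f y) + \<theta>\<^sub>0\<^sup>2 / 2 * wnorm_sq b B (v \<circ>\<^sub>v vpowi p (-2)) (x0 - y))
          / ((real k - 1) * \<theta>\<^sub>0 + 1)) \<and>
     (\<theta>\<^sub>0 = (MIN i. p $ i) \<longrightarrow>
       (\<forall>k\<ge>1.
         max (\<integral>\<omega>. f (ALPHA_average \<theta>\<^sub>0 (\<lambda>l. xs l \<omega>) k) \<partial>M) (MIN l\<in>{1..k}. \<integral>\<omega>. f (xs l \<omega>) \<partial>M) - f y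
         \<le> ((1 - (MIN i. p $ i)) * (f x0 - f y) + 1/2 * wnorm_sq b B v (x0 - y))
            / ((real k - 1) * (MIN i. p $ i) + 1)))"
proof -
  interpret prob_space M by (rule M)
  have meas: "S j \<in> measurable M (count_space UNIV)" for j
    using S_indep by (simp add: indep_vars_def)
  define w where "w = v \<circ>\<^sub>v vpowi p (-2)"
  define E where "E k = (\<integral>\<omega>. f (xs k \<omega>) \<partial>M)" for k
  define r where "r k = \<theta>\<^sub>0\<^sup>2 / 2 * (\<integral>\<omega>. wnorm_sq b B w (zs k \<omega> - y) \<partial>M)" for k
  define C where "C = (1 - \<theta>\<^sub>0) * (f x0 - f y) + \<theta>\<^sub>0\<^sup>2 / 2 * wnorm_sq b B w (x0 - y)"
  have p_pos: "0 < p $ i" for i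
    using proper by (simp add: p proper_sampling_def)
  have w_eq: "w $ i = v $ i / (p $ i)\<^sup>2" for i
    by (simp add: w_def vmult_def vpowi_def power_int_minus divide_inverse)
  have "0 \<le> wnorm_sq b B w h" for h
    unfolding wnorm_sq_eq w_eq
    by (intro sum_nonneg mult_nonneg_nonneg divide_nonneg_nonneg blk_sq_nonneg B)
      (use v_pos in \<open>auto intro: less_imp_le\<close>)
  then have r_nonneg: "0 \<le> r k" for k
    by (simp add: r_def)
  have rec: "(E (Suc k) - f y) + r (Suc k) \<le> (1 - \<theta>\<^sub>0) * (E k - f y) + r k" for k
    using smooth_ALPHA_expectation_recursion[OF B f_convex f_diff proper p v_pos eso \<theta>\<^sub>0 M
        S_indep S_distr run, of k y]
    unfolding E_def r_def w_def by (simp add: algebra_simps)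
  have start: "xs 0 \<omega> = x0" "zs 0 \<omega> = x0" if "\<omega> \<in> space M" for \<omega>
    using run[OF that] by (simp_all add: smooth_ALPHA_def)
  have init: "E 0 = f x0" "r 0 = \<theta>\<^sub>0\<^sup>2 / 2 * wnorm_sq b B w (x0 - y)"
    using start by (simp_all add: E_def r_def prob_space cong: Bochner_Integration.integral_cong)
  have A: "ALPHA_iter b B f p v \<theta>\<^sub>0 x0 (\<lambda>j. S j \<omega>) l = (xs l \<omega>, zs l \<omega>)" if "\<omega> \<in> space M" for \<omega> l
    by (rule smooth_ALPHA_iter[OF B run[OF that]])
  have xs_past: "xs l \<omega> = fst (ALPHA_iter b B f p v \<theta>\<^sub>0 x0 (\<lambda>i\<in>{..<k}. S i \<omega>) l)"
    if "\<omega> \<in> space M" "l \<le> k" for \<omega> l k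
  proof -
    have "ALPHA_iter b B f p v \<theta>\<^sub>0 x0 (\<lambda>i\<in>{..<k}. S i \<omega>) l
        = ALPHA_iter b B f p v \<theta>\<^sub>0 x0 (\<lambda>j. S j \<omega>) l"
      using that by (intro ALPHA_iter_cong) auto
    then show ?thesis
      by (simp add: A that)
  qed
  have int: "integrable M (\<lambda>\<omega>. f (xs k \<omega>))" for k
    by (rule integrable_past[OF meas, where k = k and F =
          "\<lambda>h. f (fst (ALPHA_iter b B f p v \<theta>\<^sub>0 x0 h k))"]) (simp add: xs_past[of _ k k])
  have bound: "max (\<integral>\<omega>. f (ALPHA_average \<theta>\<^sub>0 (\<lambda>l. xs l \<omega>) k) \<partial>M) (MIN l\<in>{1..k}. E l) - f y
      \<le> C / ((real k - 1) * \<theta>\<^sub>0 + 1)" if k: "1 \<le> k" for k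
  proof -
    define W where "W = 1 + (real k - 1) * \<theta>\<^sub>0"
    have W: "0 < W"
      using \<theta>\<^sub>0 k by (simp add: W_def add_pos_nonneg)
    have "(\<integral>\<omega>. f (ALPHA_average \<theta>\<^sub>0 (\<lambda>l. xs l \<omega>) k) \<partial>M)
        \<le> (\<integral>\<omega>. (f (xs k \<omega>) + \<theta>\<^sub>0 * (\<Sum>l=1..k-1. f (xs l \<omega>))) / W \<partial>M)"
    proof (rule integral_mono)
      show "integrable M (\<lambda>\<omega>. f (ALPHA_average \<theta>\<^sub>0 (\<lambda>l. xs l \<omega>) k))"
      proof (rule integrable_past[OF meas, where k = k and F =
            "\<lambda>h. f (ALPHA_average \<theta>\<^sub>0 (\<lambda>l. fst (ALPHA_iter b B f p v \<theta>\<^sub>0 x0 h l)) k)"])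
        fix \<omega> assume \<omega>: "\<omega> \<in> space M"
        have "(\<Sum>l=1..k-1. xs l \<omega>)
            = (\<Sum>l=1..k-1. fst (ALPHA_iter b B f p v \<theta>\<^sub>0 x0 (\<lambda>i\<in>{..<k}. S i \<omega>) l))"
          by (intro sum.cong refl xs_past[OF \<omega>]) auto
        then show "f (ALPHA_average \<theta>\<^sub>0 (\<lambda>l. xs l \<omega>) k)
            = f (ALPHA_average \<theta>\<^sub>0 (\<lambda>l. fst (ALPHA_iter b B f p v \<theta>\<^sub>0 x0 (\<lambda>i\<in>{..<k}. S i \<omega>) l)) k)"
          by (simp add: ALPHA_average_def xs_past[OF \<omega>, of k k])
      qed
      show "integrable M (\<lambda>\<omega>. (f (xs k \<omega>) + \<theta>\<^sub>0 * (\<Sum>l=1..k-1. f (xs l \<omega>))) / W)"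
        using int by simp
      show "f (ALPHA_average \<theta>\<^sub>0 (\<lambda>l. xs l \<omega>) k)
          \<le> (f (xs k \<omega>) + \<theta>\<^sub>0 * (\<Sum>l=1..k-1. f (xs l \<omega>))) / W" for \<omega>
        unfolding W_def by (rule convex_ALPHA_average[OF f_convex \<theta>\<^sub>0(1) k])
    qed
    also have "\<dots> = (E k + \<theta>\<^sub>0 * (\<Sum>l=1..k-1. E l)) / W"
      using int by (simp add: E_def)
    finally have "max (\<integral>\<omega>. f (ALPHA_average \<theta>\<^sub>0 (\<lambda>l. xs l \<omega>) k) \<partial>M) (MIN l\<in>{1..k}. E l)
        \<le> (E k + \<theta>\<^sub>0 * (\<Sum>l=1..k-1. E l)) / W"
      using Min_le_weighted_average[OF \<theta>\<^sub>0(1) k, of E] by (simp add: W_def)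
    also have "\<dots> = ((E k - f y) + \<theta>\<^sub>0 * (\<Sum>l=1..k-1. E l - f y)) / W + f y"
      using W k by (simp add: W_def field_simps sum_subtractf of_nat_diff)
    also have "\<dots> \<le> C / W + f y"
      using sum_recursion_bound[of "\<lambda>k. E k - f y" r \<theta>\<^sub>0, OF rec r_nonneg k] W
      by (simp add: C_def init divide_right_mono)
    also have "W = (real k - 1) * \<theta>\<^sub>0 + 1"
      by (simp add: W_def)
    finally show ?thesis
      by linarith
  qed
  have "C \<le> (1 - \<theta>\<^sub>0) * (f x0 - f y) + 1/2 * wnorm_sq b B v (x0 - y)" if min: "\<theta>\<^sub>0 = (MIN i. p $ i)"
  proof -
    have "\<theta>\<^sub>0\<^sup>2 * wnorm_sq b B w (x0 - y) \<le> wnorm_sq b B v (x0 - y)"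
      unfolding wnorm_sq_eq sum_distrib_left
    proof (rule sum_mono)
      fix i
      have "\<theta>\<^sub>0 \<le> p $ i"
        unfolding min by (rule Min_le) auto
      then have "\<theta>\<^sub>0\<^sup>2 \<le> (p $ i)\<^sup>2"
        using \<theta>\<^sub>0 by (intro power_mono) auto
      then have "\<theta>\<^sub>0\<^sup>2 * w $ i \<le> v $ i"
        using p_pos[of i] v_pos[of i] by (simp add: w_eq pos_divide_le_eq mult.commute)
      then show "\<theta>\<^sub>0\<^sup>2 * (w $ i * blk_sq b B i (x0 - y)) \<le> v $ i * blk_sq b B i (x0 - y)"
        unfolding mult.assoc[symmetric] by (intro mult_right_mono blk_sq_nonneg B)
    qed
    then show ?thesis
      by (simp add: C_def)
  qed
  then have C_le: "C / ((real k - 1) * \<theta>\<^sub>0 + 1)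
      \<le> ((1 - \<theta>\<^sub>0) * (f x0 - f y) + 1/2 * wnorm_sq b B v (x0 - y)) / ((real k - 1) * \<theta>\<^sub>0 + 1)"
    if "\<theta>\<^sub>0 = (MIN i. p $ i)" "1 \<le> k" for k
  proof (rule divide_right_mono)
    show "0 \<le> (real k - 1) * \<theta>\<^sub>0 + 1"
      using that(2) \<theta>\<^sub>0 by simp
  qed (use that in blast)
  show ?thesis
  proof (intro conjI impI allI)
    fix k :: nat assume k: "1 \<le> k"
    show "max (\<integral>\<omega>. f (ALPHA_average \<theta>\<^sub>0 (\<lambda>l. xs l \<omega>) k) \<partial>M) (MIN l\<in>{1..k}. \<integral>\<omega>. f (xs l \<omega>) \<partial>M) - f y
       \<le> ((1 - \<theta>\<^sub>0) * (f x0 - f y) + \<theta>\<^sub>0\<^sup>2 / 2 * wnorm_sq b B (v \<circ>\<^sub>v vpowi p (-2)) (x0 - y))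
          / ((real k - 1) * \<theta>\<^sub>0 + 1)"
      using bound[OF k] unfolding C_def E_def w_def .
  next
    fix k :: nat assume min: "\<theta>\<^sub>0 = (MIN i. p $ i)" and k: "1 \<le> k"
    show "max (\<integral>\<omega>. f (ALPHA_average \<theta>\<^sub>0 (\<lambda>l. xs l \<omega>) k) \<partial>M) (MIN l\<in>{1..k}. \<integral>\<omega>. f (xs l \<omega>) \<partial>M) - f y
         \<le> ((1 - (MIN i. p $ i)) * (f x0 - f y) + 1/2 * wnorm_sq b B v (x0 - y))
            / ((real k - 1) * (MIN i. p $ i) + 1)"
      using order_trans[OF bound[OF k] C_le[OF min k]] unfolding E_def min[symmetric] .
  qed
qed

end
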